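(* Let $l\ge 2$ and let $L_{rel}$, $\mathbf{C}_n$, $\mathbf{S}_n$ and the probability measures $\delta_n^{\mathbf{C}}$ on $\mathbf{C}_n$ and $\delta_n^{\mathbf{S}}$ on $\mathbf{S}_n$ be as in the context. For every sentence $\varphi\in L_{rel}$: (i) $\lim_{n\to\infty}\delta_n^{\mathbf{C}}(\varphi)=0$ or $\lim_{n\to\infty}\delta_n^{\mathbf{C}}(\varphi)=1$, and (ii) (if, in addition, every relation symbol of $L_{rel}$ has arity at most $l$) $\lim_{n\to\infty}\delta_n^{\mathbf{S}}(\varphi)=0$ or $\lim_{n\to\infty}\delta_n^{\mathbf{S}}(\varphi)=1$. Here $\delta_n^{\mathbf{C}}(\varphi)=\delta_n^{\mathbf{C}}(\{\mathcal{M}\in\mathbf{C}_n:\mathcal{M}\models\varphi\})$ and similarly for $\mathbf{S}$.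
   Context: $l\ge2$ is a fixed integer. $L_{rel}$ is a first-order language with finite nonempty relational vocabulary, all of whose symbols have arity at least $2$. $L$ is the language whose vocabulary consists of that of $L_{rel}$ together with $l$ new unary relation symbols $P_1,\ldots,P_l$ ("colours"). An element $a$ of an $L$-structure has colour $i$ if it satisfies $P_i$. For $n\ge1$, $\mathbf{K}_n$ is the set of all $L$-structures $\mathcal{M}$ with universe $\{1,\ldots,n\}$ such that every element has exactly one colour and whenever $R$ is a relation symbol of $L_{rel}$ and $\mathcal{M}\models R(a_1,\ldots,a_m)$, at least two of $a_1,\ldots,a_m$ have different colours. $\mathbf{SK}_n$ is defined in the same way except that the last requirement is replaced by: whenever $\mathcal{M}\models R(a_1,\ldots,a_m)$, $a_i$ and $a_j$ have different colours for all $i\ne j$. $\mathbf{C}_n=\{\mathcal{M}\upharpoonright L_{rel}:\mathcal{M}\in\mathbf{K}_n\}$ and $\mathbf{S}_n=\{\mathcal{M}\upharpoonright L_{rel}:\mathcal{M}\in\mathbf{SK}_n\}$ (reducts). Dimension conditional measure (trivial pregeometry) on $\mathbf{X}_n$, for $\mathbf{X}_n=\mathbf{K}_n$ or $\mathbf{SK}_n$: for $\mathcal{M}\in\mathbf{X}_n$ and $d\in\mathbb{N}$, $\mathcal{M}\upharpoonright d$ is the $L$-structure with the same universe in which, for each relation symbol $R$ of $L$, $\bar a\in R^{\mathcal{M}\upharpoonright d}$ iff $\bar a\in R^{\mathcal{M}}$ and at most $d$ distinct elements occur in $\bar a$. $\mathbf{X}_n\upharpoonright d=\{\mathcal{M}\upharpoonright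 d:\mathcal{M}\in\mathbf{X}_n\}$. $\mathbb{P}_{n,0}$ is the uniform probability measure on $\mathbf{X}_n\upharpoonright0$ and, for $\mathcal{B}\in\mathbf{X}_n\upharpoonright(r+1)$, $\mathbb{P}_{n,r+1}(\mathcal{B})=\mathbb{P}_{n,r}(\mathcal{B}\upharpoonright r)\big/\big|\{\mathcal{B}'\in\mathbf{X}_n\upharpoonright(r+1):\mathcal{B}'\upharpoonright r=\mathcal{B}\upharpoonright r\}\big|$. With $\rho$ the largest arity of a relation symbol of $L$, the dimension conditional measure on $\mathbf{X}_n=\mathbf{X}_n\upharpoonright\rho$ is $\mathbb{P}_{n,\rho}$; it is denoted $\delta_n^{\mathbf{K}}$ for $\mathbf{K}_n$ and $\delta_n^{\mathbf{SK}}$ for $\mathbf{SK}_n$. For $\mathbf{Y}\subseteq\mathbf{C}_n$, $\delta_n^{\mathbf{C}}(\mathbf{Y})=\delta_n^{\mathbf{K}}(\{\mathcal{M}\in\mathbf{K}_n:\mathcal{M}\upharpoonright L_{rel}\in\mathbf{Y}\})$; for $\mathbf{Y}\subseteq\mathbf{S}_n$, $\delta_n^{\mathbf{S}}(\mathbf{Y})=\delta_n^{\mathbf{SK}}(\{\mathcal{M}\in\mathbf{SK}_n:\mathcal{M}\upharpoonright L_{rel}\in\mathbf{Y}\})$. *)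

theory Defs
  imports "HOL-Analysis.Analysis"
begin

section \<open>First-order logic over relational vocabularies\<close>

record 's vocabulary =
  syms :: "'s set"
  arity :: "'s \<Rightarrow> nat"

text \<open>Formulas with equality. Variables are natural numbers; the remaining connectives and the
  universal quantifier are definable.\<close>

datatype 's fm =
    Eq nat nat
  | Rel 's "nat list"
  | Neg "'s fm"
  | Conj "'s fm" "'s fm"
  | Ex nat "'s fm"

primrec fvars :: "'s fm \<Rightarrow> nat set" where
  "fvars (Eq x y) = {x, y}"
| "fvars (Rel R xs) = set xs"
| "fvars (Neg \<phi>) = fvars \<phi>"
| "fvars (Conj \<phi> \<psi>) = fvars \<phi> \<union> fvars \<psi>"
| "fvars (Ex x \<phi>) = fvars \<phi> - {x}"

primrec wff :: "'s vocabulary \<Rightarrow> 's fm \<Rightarrow> bool" where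
  "wff V (Eq x y) \<longleftrightarrow> True"
| "wff V (Rel R xs) \<longleftrightarrow> R \<in> syms V \<and> length xs = arity V R"
| "wff V (Neg \<phi>) \<longleftrightarrow> wff V \<phi>"
| "wff V (Conj \<phi> \<psi>) \<longleftrightarrow> wff V \<phi> \<and> wff V \<psi>"
| "wff V (Ex x \<phi>) \<longleftrightarrow> wff V \<phi>"

definition sentences :: "'s vocabulary \<Rightarrow> 's fm set" where
  "sentences V = {\<phi>. wff V \<phi> \<and> fvars \<phi> = {}}"

text \<open>A structure with a given universe is identified with the interpretation of its symbols.
  Symbols outside the vocabulary are interpreted as empty, so that distinct elements of
  \<open>structures V n\<close> are distinct structures.\<close>

type_synonym 's struc = "'s \<Rightarrow> nat list set"

definition structures :: "'s vocabulary \<Rightarrow> nat \<Rightarrow> 's struc set" where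
  "structures V n =
     {M. (\<forall>R\<in>syms V. M R \<subseteq> {as. length as = arity V R \<and> set as \<subseteq> {1..n}}) \<and>
         (\<forall>R. R \<notin> syms V \<longrightarrow> M R = {})}"

primrec sat :: "nat set \<Rightarrow> 's struc \<Rightarrow> (nat \<Rightarrow> nat) \<Rightarrow> 's fm \<Rightarrow> bool" where
  "sat A M e (Eq x y) \<longleftrightarrow> e x = e y"
| "sat A M e (Rel R xs) \<longleftrightarrow> map e xs \<in> M R"
| "sat A M e (Neg \<phi>) \<longleftrightarrow> \<not> sat A M e \<phi>"
| "sat A M e (Conj \<phi> \<psi>) \<longleftrightarrow> sat A M e \<phi> \<and> sat A M e \<psi>"
| "sat A M e (Ex x \<phi>) \<longleftrightarrow> (\<exists>a\<in>A. sat A M (e(x := a)) \<phi>)"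

definition models :: "nat \<Rightarrow> 's struc \<Rightarrow> 's fm \<Rightarrow> bool" where
  "models n M \<phi> \<longleftrightarrow> (\<forall>e. range e \<subseteq> {1..n} \<longrightarrow> sat {1..n} M e \<phi>)"


section \<open>Coloured structures\<close>

datatype 'r csym = RelSym 'r | Colour nat

definition coloured :: "'r vocabulary \<Rightarrow> nat \<Rightarrow> 'r csym vocabulary" where
  "coloured V l =
     \<lparr>syms = RelSym ` syms V \<union> Colour ` {1..l},
      arity = (\<lambda>s. case s of RelSym R \<Rightarrow> arity V R | Colour i \<Rightarrow> 1)\<rparr>"

definition has_colour :: "'r csym struc \<Rightarrow> nat \<Rightarrow> nat \<Rightarrow> bool" where
  "has_colour M a i \<longleftrightarrow> [a] \<in> M (Colour i)"

definition diff_colours :: "nat \<Rightarrow> 'r csym struc \<Rightarrow> nat \<Rightarrow> nat \<Rightarrow> bool" where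
  "diff_colours l M a b \<longleftrightarrow>
     (\<exists>i\<in>{1..l}. \<exists>j\<in>{1..l}. i \<noteq> j \<and> has_colour M a i \<and> has_colour M b j)"

definition Kn :: "'r vocabulary \<Rightarrow> nat \<Rightarrow> nat \<Rightarrow> 'r csym struc set" where
  "Kn V l n =
     {M \<in> structures (coloured V l) n.
        (\<forall>a\<in>{1..n}. \<exists>!i. i \<in> {1..l} \<and> has_colour M a i) \<and>
        (\<forall>R\<in>syms V. \<forall>as\<in>M (RelSym R). \<exists>a\<in>set as. \<exists>b\<in>set as. diff_colours l M a b)}"

definition SKn :: "'r vocabulary \<Rightarrow> nat \<Rightarrow> nat \<Rightarrow> 'r csym struc set" where
  "SKn V l n =
     {M \<in> structures (coloured V l) n.
        (\<forall>a\<in>{1..n}. \<exists>!i. i \<in> {1..l} \<and> has_colour M a i) \<and>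
        (\<forall>R\<in>syms V. \<forall>as\<in>M (RelSym R).
           \<forall>i<length as. \<forall>j<length as. i \<noteq> j \<longrightarrow> diff_colours l M (as ! i) (as ! j))}"

definition reduct :: "'r csym struc \<Rightarrow> 'r struc" where
  "reduct M = (\<lambda>R. M (RelSym R))"

definition Cn :: "'r vocabulary \<Rightarrow> nat \<Rightarrow> nat \<Rightarrow> 'r struc set" where
  "Cn V l n = reduct ` Kn V l n"

definition Sn :: "'r vocabulary \<Rightarrow> nat \<Rightarrow> nat \<Rightarrow> 'r struc set" where
  "Sn V l n = reduct ` SKn V l n"


section \<open>The dimension conditional measure\<close>

definition restr :: "nat \<Rightarrow> 's struc \<Rightarrow> 's struc" where
  "restr d M = (\<lambda>R. {as \<in> M R. card (set as) \<le> d})"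

text \<open>\<open>dc_mass X r B\<close> is the probability of the point \<open>B \<in> restr r ` X\<close>; it has no intended
  meaning for other arguments \<open>B\<close>.\<close>

primrec dc_mass :: "'s struc set \<Rightarrow> nat \<Rightarrow> 's struc \<Rightarrow> real" where
  "dc_mass X 0 B = 1 / real (card (restr 0 ` X))"
| "dc_mass X (Suc r) B =
     dc_mass X r (restr r B) / real (card {B' \<in> restr (Suc r) ` X. restr r B' = restr r B})"

definition dc_measure :: "'s struc set \<Rightarrow> nat \<Rightarrow> 's struc measure" where
  "dc_measure X r = point_measure (restr r ` X) (\<lambda>B. ennreal (dc_mass X r B))"

definition max_arity :: "'s vocabulary \<Rightarrow> nat" where
  "max_arity V = Max (arity V ` syms V)"

definition delta_K :: "'r vocabulary \<Rightarrow> nat \<Rightarrow> nat \<Rightarrow> 'r csym struc measure" where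
  "delta_K V l n = dc_measure (Kn V l n) (max_arity (coloured V l))"

definition delta_SK :: "'r vocabulary \<Rightarrow> nat \<Rightarrow> nat \<Rightarrow> 'r csym struc measure" where
  "delta_SK V l n = dc_measure (SKn V l n) (max_arity (coloured V l))"

definition delta_C :: "'r vocabulary \<Rightarrow> nat \<Rightarrow> nat \<Rightarrow> 'r struc set \<Rightarrow> real" where
  "delta_C V l n Y = measure (delta_K V l n) {M \<in> Kn V l n. reduct M \<in> Y}"

definition delta_S :: "'r vocabulary \<Rightarrow> nat \<Rightarrow> nat \<Rightarrow> 'r struc set \<Rightarrow> real" where
  "delta_S V l n Y = measure (delta_SK V l n) {M \<in> SKn V l n. reduct M \<in> Y}"


section \<open>Well-definedness\<close>

text \<open>The measures live on \<open>Kn V l n\<close> and \<open>SKn V l n\<close> and have total mass one.\<close>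

lemma finite_syms_coloured: "finite (syms V) \<Longrightarrow> finite (syms (coloured V l))"
  by (simp add: coloured_def)

lemma restr_restr: "restr r (restr (Suc r) M) = restr r M"
  by (auto simp: restr_def fun_eq_iff)

lemma restr_max_arity:
  assumes "finite (syms V)" "M \<in> structures V n"
  shows "restr (max_arity V) M = M"
proof
  fix R
  have "card (set as) \<le> max_arity V" if as: "as \<in> M R" for as
  proof -
    have R: "R \<in> syms V" using as assms(2) by (auto simp: structures_def)
    then have "length as = arity V R" using as assms(2) by (auto simp: structures_def)
    moreover have "arity V R \<le> max_arity V"
      using assms(1) R by (simp add: max_arity_def)
    ultimately show ?thesis using card_length[of as] by linarith
  qed
  then show "restr (max_arity V) M R = M R" by (auto simp: restr_def)
qed

lemma restr_max_arity_image:
  assumes "finite (syms V)" "X \<subseteq> structures V n"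
  shows "restr (max_arity V) ` X = X"
  using restr_max_arity[OF assms(1)] assms(2) by (force simp: image_iff)

lemma finite_structures:
  assumes "finite (syms V)"
  shows "finite (structures V n)"
proof -
  let ?T = "\<lambda>R. {as. set as \<subseteq> {1..n} \<and> length as = arity V R}"
  have "finite (\<Union>R\<in>syms V. ?T R)"
    using assms by (intro finite_UN_I) (auto intro: finite_lists_length_eq)
  then have "finite {M. \<forall>R. (R \<in> syms V \<longrightarrow> M R \<in> Pow (\<Union>R\<in>syms V. ?T R)) \<and>
      (R \<notin> syms V \<longrightarrow> M R = {})}"
    using assms by (intro finite_set_of_finite_funs) auto
  then show ?thesis
    by (rule rev_finite_subset) (fastforce simp: structures_def)
qed

lemma dc_mass_nonneg: "dc_mass X r B \<ge> 0"
  by (induction r arbitrary: B) auto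

lemma sum_dc_mass:
  assumes "finite X" "X \<noteq> {}"
  shows "(\<Sum>B\<in>restr r ` X. dc_mass X r B) = 1"
proof (induction r)
  case 0
  show ?case using assms by simp
next
  case (Suc r)
  let ?F = "\<lambda>A. {B \<in> restr (Suc r) ` X. restr r B = A}"
  have "(\<Sum>B\<in>restr (Suc r) ` X. dc_mass X (Suc r) B) =
      (\<Sum>A\<in>restr r ` X. \<Sum>B\<in>?F A. dc_mass X (Suc r) B)"
    using assms(1) by (intro sum.group[symmetric]) (auto simp: restr_restr)
  also have "\<dots> = (\<Sum>A\<in>restr r ` X. dc_mass X r A)"
  proof (rule sum.cong[OF refl])
    fix A assume "A \<in> restr r ` X"
    then obtain M where "M \<in> X" "A = restr r M" by auto
    then have "restr (Suc r) M \<in> ?F A" by (simp add: restr_restr)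
    then have "card (?F A) \<noteq> 0" using assms(1) by (auto simp: card_eq_0_iff)
    moreover have "(\<Sum>B\<in>?F A. dc_mass X (Suc r) B) =
        (\<Sum>B\<in>?F A. dc_mass X r A / real (card (?F A)))"
      by (rule sum.cong) auto
    ultimately show "(\<Sum>B\<in>?F A. dc_mass X (Suc r) B) = dc_mass X r A"
      by simp
  qed
  finally show ?case using Suc.IH by simp
qed

lemma Kn_subset: "Kn V l n \<subseteq> structures (coloured V l) n"
  by (auto simp: Kn_def)

lemma SKn_subset: "SKn V l n \<subseteq> structures (coloured V l) n"
  by (auto simp: SKn_def)

lemma one_coloured:
  fixes n :: nat
  assumes "l \<ge> 1"
  defines "M \<equiv> (\<lambda>s. case s of RelSym R \<Rightarrow> {} | Colour i \<Rightarrow> if i = 1 then {[a] |a. a \<in> {1..n}} else {})"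
  shows "M \<in> Kn V l n" "M \<in> SKn V l n"
proof -
  have "M \<in> structures (coloured V l) n"
    using assms(1) by (auto simp: M_def structures_def coloured_def split: csym.splits if_splits)
  moreover have "\<exists>!i. i \<in> {1..l} \<and> has_colour M a i" if "a \<in> {1..n}" for a
    using that assms(1) by (intro ex1I[of _ 1]) (auto simp: M_def has_colour_def split: if_splits)
  moreover have "M (RelSym R) = {}" for R by (simp add: M_def)
  ultimately show "M \<in> Kn V l n" "M \<in> SKn V l n" by (auto simp: Kn_def SKn_def)
qed

lemma
  assumes "l \<ge> 1"
  shows Kn_nonempty: "Kn V l n \<noteq> {}" and SKn_nonempty: "SKn V l n \<noteq> {}"
  by (rule ex_in_conv[THEN iffD1, OF exI], rule one_coloured[OF assms])+

lemma
  assumes "finite (syms V)"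
  shows space_delta_K: "space (delta_K V l n) = Kn V l n"
    and space_delta_SK: "space (delta_SK V l n) = SKn V l n"
    and sets_delta_K: "sets (delta_K V l n) = Pow (Kn V l n)"
    and sets_delta_SK: "sets (delta_SK V l n) = Pow (SKn V l n)"
  using restr_max_arity_image[OF finite_syms_coloured[OF assms] Kn_subset]
    restr_max_arity_image[OF finite_syms_coloured[OF assms] SKn_subset]
  by (simp_all add: delta_K_def delta_SK_def dc_measure_def space_point_measure sets_point_measure)

lemma emeasure_dc_measure_space:
  assumes "finite X" "X \<noteq> {}"
  shows "emeasure (dc_measure X r) (space (dc_measure X r)) = 1"
  using assms sum_dc_mass[OF assms, of r]
  by (simp add: dc_measure_def space_point_measure emeasure_point_measure_finite
      dc_mass_nonneg sum_ennreal)

lemma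
  assumes "finite (syms V)" "l \<ge> 1"
  shows emeasure_delta_K_space: "emeasure (delta_K V l n) (space (delta_K V l n)) = 1"
    and emeasure_delta_SK_space: "emeasure (delta_SK V l n) (space (delta_SK V l n)) = 1"
  unfolding delta_K_def delta_SK_def
  using finite_subset[OF Kn_subset finite_structures[OF finite_syms_coloured[OF assms(1)]]]
    finite_subset[OF SKn_subset finite_structures[OF finite_syms_coloured[OF assms(1)]]]
  by (auto intro!: emeasure_dc_measure_space simp: Kn_nonempty[OF assms(2)] SKn_nonempty[OF assms(2)])

end

theory Submission
  imports Defs "HOL-Real_Asymp.Real_Asymp"
begin

text \<open>A structure distributed according to the dimension conditional measure arises as follows: colour
  the elements uniformly and independently, toss a fair coin for every tuple, and keep the tuples
  with a successful coin and an admissible colour pattern. For a fixed set of at most \<open>k\<close> elements,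
  distinct further elements realize a prescribed coloured one-point extension independently, with
  probability bounded below in terms of \<open>k\<close>. Hence the \<open>k\<close>-extension property fails with probability
  at most a polynomial in \<open>n\<close> times an exponentially small factor. By a back-and-forth argument, structures
  with the \<open>k\<close>-extension property agree on all sentences of quantifier rank at most \<open>k\<close>.\<close>

section \<open>Dimension conditional measures as images of uniform measures\<close>

lemma measure_dc_measure:
  assumes "finite X" "Y \<subseteq> restr r ` X"
  shows "measure (dc_measure X r) Y = (\<Sum>B\<in>Y. dc_mass X r B)"
  using assms
  by (simp add: measure_def dc_measure_def emeasure_point_measure_finite dc_mass_nonneg
      sum_ennreal sum_nonneg)

text \<open>Induction on \<open>r\<close>. A fibre at level \<open>r\<close> splits into fibres at
  level \<open>Suc r\<close>, one for each extension, and \<open>fibres\<close> makes these equally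
  large. Passing to one of them divides the proportion by the number of extensions, which is the
  recursion of \<open>dc_mass\<close>; \<open>triv\<close> gives mass 1 at level 0.\<close>

lemma dc_mass_eq_card_fibre:
  assumes fin: "finite \<Omega>" and ne: "\<Omega> \<noteq> {}"
    and triv: "\<And>x y. x \<in> \<Omega> \<Longrightarrow> y \<in> \<Omega> \<Longrightarrow> restr 0 (f x) = restr 0 (f y)"
    and fibres: "\<And>r x y. x \<in> \<Omega> \<Longrightarrow> y \<in> \<Omega> \<Longrightarrow> restr r (f x) = restr r (f y) \<Longrightarrow>
      card {z \<in> \<Omega>. restr (Suc r) (f z) = restr (Suc r) (f x)} =
      card {z \<in> \<Omega>. restr (Suc r) (f z) = restr (Suc r) (f y)}"
    and x: "x \<in> \<Omega>"
  shows "dc_mass (f ` \<Omega>) r (restr r (f x)) =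
    card {z \<in> \<Omega>. restr r (f z) = restr r (f x)} / card \<Omega>"
  using x
proof (induction r arbitrary: x)
  case 0
  have "restr 0 ` f ` \<Omega> = {restr 0 (f x)}" using triv 0 by blast
  moreover have "{z \<in> \<Omega>. restr 0 (f z) = restr 0 (f x)} = \<Omega>" using triv 0 by blast
  ultimately show ?case using fin ne by simp
next
  case (Suc r)
  let ?E = "{B \<in> restr (Suc r) ` f ` \<Omega>. restr r B = restr r (f x)}"
  let ?F = "\<lambda>B. {z \<in> \<Omega>. restr (Suc r) (f z) = B}"
  have card_eq: "card (?F B) = card (?F (restr (Suc r) (f x)))" if B: "B \<in> ?E" for B
  proof -
    obtain y where "y \<in> \<Omega>" "B = restr (Suc r) (f y)" using B by auto
    moreover from this have "restr r (f y) = restr r (f x)" using B by (simp add: restr_restr)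
    ultimately show ?thesis using fibres Suc.prems by blast
  qed
  have "{z \<in> \<Omega>. restr r (f z) = restr r (f x)} = (\<Union>B\<in>?E. ?F B)"
    by (auto simp: restr_restr image_iff) (metis restr_restr)
  also have "card \<dots> = (\<Sum>B\<in>?E. card (?F B))"
    using fin by (intro card_UN_disjoint) auto
  also have "\<dots> = card ?E * card (?F (restr (Suc r) (f x)))"
    using card_eq by simp
  finally have "real (card {z \<in> \<Omega>. restr r (f z) = restr r (f x)}) =
      real (card ?E) * real (card (?F (restr (Suc r) (f x))))" by simp
  moreover have "card ?E \<noteq> 0"
    using fin Suc.prems by (auto simp: restr_restr)
  ultimately show ?case
    using Suc by (simp add: restr_restr)
qed

text \<open>By \<open>full\<close>, the fibres at level \<open>r\<close> are the preimages under
  \<open>f\<close>. So the measure is the image under \<open>f\<close> of the uniform measure on the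
  sample space.\<close>

lemma measure_dc_measure_image:
  assumes fin: "finite \<Omega>" and ne: "\<Omega> \<noteq> {}"
    and triv: "\<And>x y. x \<in> \<Omega> \<Longrightarrow> y \<in> \<Omega> \<Longrightarrow> restr 0 (f x) = restr 0 (f y)"
    and fibres: "\<And>r x y. x \<in> \<Omega> \<Longrightarrow> y \<in> \<Omega> \<Longrightarrow> restr r (f x) = restr r (f y) \<Longrightarrow>
      card {z \<in> \<Omega>. restr (Suc r) (f z) = restr (Suc r) (f x)} =
      card {z \<in> \<Omega>. restr (Suc r) (f z) = restr (Suc r) (f y)}"
    and full: "\<And>x. x \<in> \<Omega> \<Longrightarrow> restr r (f x) = f x"
  shows "measure (dc_measure (f ` \<Omega>) r) {M \<in> f ` \<Omega>. P M} = card {x \<in> \<Omega>. P (f x)} / card \<Omega>"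
proof -
  let ?Y = "{M \<in> f ` \<Omega>. P M}"
  have Y: "?Y \<subseteq> restr r ` f ` \<Omega>" using full by force
  have mass: "dc_mass (f ` \<Omega>) r M = card {z \<in> \<Omega>. f z = M} / card \<Omega>" if M: "M \<in> ?Y" for M
  proof -
    obtain x where x: "x \<in> \<Omega>" "M = f x" using M by auto
    have "{z \<in> \<Omega>. restr r (f z) = restr r (f x)} = {z \<in> \<Omega>. f z = M}"
      using full x by auto
    moreover have "dc_mass (f ` \<Omega>) r (restr r (f x)) =
        card {z \<in> \<Omega>. restr r (f z) = restr r (f x)} / card \<Omega>"
      using fin ne triv fibres x(1) by (rule dc_mass_eq_card_fibre)
    ultimately show ?thesis
      using full[OF x(1)] x(2) by metis
  qed
  have "measure (dc_measure (f ` \<Omega>) r) ?Y = (\<Sum>M\<in>?Y. real (card {z \<in> \<Omega>. f z = M}) / card \<Omega>)"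
    using measure_dc_measure[OF _ Y] fin mass by simp
  also have "\<dots> = real (\<Sum>M\<in>?Y. card {z \<in> \<Omega>. f z = M}) / card \<Omega>"
    by (simp add: sum_divide_distrib)
  also have "(\<Sum>M\<in>?Y. card {z \<in> \<Omega>. f z = M}) = card (\<Union>M\<in>?Y. {z \<in> \<Omega>. f z = M})"
    using fin by (intro card_UN_disjoint[symmetric]) auto
  also have "(\<Union>M\<in>?Y. {z \<in> \<Omega>. f z = M}) = {x \<in> \<Omega>. P (f x)}" by auto
  finally show ?thesis .
qed

primrec qrank :: "'s fm \<Rightarrow> nat" where
  "qrank (Eq x y) = 0"
| "qrank (Rel R xs) = 0"
| "qrank (Neg \<phi>) = qrank \<phi>"
| "qrank (Conj \<phi> \<psi>) = max (qrank \<phi>) (qrank \<psi>)"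
| "qrank (Ex x \<phi>) = Suc (qrank \<phi>)"

section \<open>Random structures built from colours and coins\<close>

text \<open>The predicate \<open>adm\<close> judges the list of colours along a tuple; this treats
  both kinds of coloured structures at once. Its assumption keeps all relations out of dimensions 0
  and 1.\<close>

locale admissible_colouring =
  fixes V :: "'r vocabulary" and l :: nat and adm :: "nat list \<Rightarrow> bool"
  assumes fin_syms: "finite (syms V)"
    and arity_ge_2: "R \<in> syms V \<Longrightarrow> arity V R \<ge> 2"
    and l_ge_2: "l \<ge> 2"
    and adm_not_constant: "adm cs \<Longrightarrow> length cs \<ge> 2 \<Longrightarrow> card (set cs) \<ge> 2"
begin

definition slots :: "nat set \<Rightarrow> ('r \<times> nat list) set" where
  "slots A = Sigma (syms V) (\<lambda>R. {as. set as \<subseteq> A \<and> length as = arity V R})"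

text \<open>A coin belongs to every tuple, even to one that the colours will forbid, so that the
  sample space is a product and colours do not influence coins. The second component collects the
  successful coins.\<close>

definition samples :: "nat \<Rightarrow> ((nat \<Rightarrow> nat) \<times> ('r \<times> nat list) set) set" where
  "samples n = ({1..n} \<rightarrow>\<^sub>E {1..l}) \<times> Pow (slots {1..n})"

definition rels :: "(nat \<Rightarrow> nat) \<times> ('r \<times> nat list) set \<Rightarrow> 'r struc" where
  "rels \<omega> R = {as. (R, as) \<in> snd \<omega> \<and> adm (map (fst \<omega>) as)}"

definition struct :: "nat \<Rightarrow> (nat \<Rightarrow> nat) \<times> ('r \<times> nat list) set \<Rightarrow> 'r csym struc" where
  "struct n \<omega> = (\<lambda>s. case s of RelSym R \<Rightarrow> rels \<omega> R
     | Colour i \<Rightarrow> {[a] |a. a \<in> {1..n} \<and> fst \<omega> a = i})"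

lemma reduct_struct [simp]: "reduct (struct n \<omega>) = rels \<omega>"
  by (simp add: reduct_def struct_def)

lemma finite_slots: "finite A \<Longrightarrow> finite (slots A)"
  unfolding slots_def using fin_syms by (auto intro: finite_lists_length_eq)

lemma finite_samples: "finite (samples n)"
  unfolding samples_def using finite_slots by (auto intro: finite_PiE)

lemma samples_nonempty: "samples n \<noteq> {}"
  using l_ge_2 by (auto simp: samples_def PiE_eq_empty_iff)

lemma in_structures_coloured:
  "M \<in> structures (coloured V l) n \<longleftrightarrow>
     (\<forall>R as. as \<in> M (RelSym R) \<longrightarrow> R \<in> syms V \<and> length as = arity V R \<and> set as \<subseteq> {1..n}) \<and>
     (\<forall>i as. as \<in> M (Colour i) \<longrightarrow> i \<in> {1..l} \<and> length as = 1 \<and> set as \<subseteq> {1..n})"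
  (is "?L \<longleftrightarrow> ?R")
proof -
  have syms: "RelSym R \<in> syms (coloured V l) \<longleftrightarrow> R \<in> syms V"
    "Colour i \<in> syms (coloured V l) \<longleftrightarrow> i \<in> {1..l}"
    and arity: "arity (coloured V l) (RelSym R) = arity V R" "arity (coloured V l) (Colour i) = 1"
    for R i by (auto simp: coloured_def)
  have all: "(\<forall>s. P s) \<longleftrightarrow> (\<forall>R. P (RelSym R)) \<and> (\<forall>i. P (Colour i))" for P :: "'r csym \<Rightarrow> bool"
    by (metis csym.exhaust)
  show ?thesis
    unfolding structures_def Ball_def mem_Collect_eq all syms arity by blast
qed

lemma struct_in_structures: "\<omega> \<in> samples n \<Longrightarrow> struct n \<omega> \<in> structures (coloured V l) n"
  by (auto simp: in_structures_coloured samples_def slots_def struct_def rels_def PiE_iff)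

lemma has_colour_struct: "has_colour (struct n \<omega>) a i \<longleftrightarrow> a \<in> {1..n} \<and> fst \<omega> a = i"
  by (simp add: has_colour_def struct_def)

lemma ex1_colour_struct:
  assumes "\<omega> \<in> samples n" "a \<in> {1..n}"
  shows "\<exists>!i. i \<in> {1..l} \<and> has_colour (struct n \<omega>) a i"
  using assms by (auto simp: has_colour_struct samples_def PiE_iff)

lemma diff_colours_struct:
  assumes "\<omega> \<in> samples n" "a \<in> {1..n}" "b \<in> {1..n}"
  shows "diff_colours l (struct n \<omega>) a b \<longleftrightarrow> fst \<omega> a \<noteq> fst \<omega> b"
  using assms by (auto simp: diff_colours_def has_colour_struct samples_def PiE_iff)

text \<open>Read the colouring off \<open>M\<close> and let exactly the coins of the tuples in
  \<open>M\<close> succeed. By the last assumption, filtering by colours then removes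
  nothing.\<close>

lemma ex_struct:
  assumes M: "M \<in> structures (coloured V l) n"
    and col: "\<forall>a\<in>{1..n}. \<exists>!i. i \<in> {1..l} \<and> has_colour M a i"
    and adm: "\<And>c R as. (\<And>a. a \<in> {1..n} \<Longrightarrow> c a \<in> {1..l} \<and> has_colour M a (c a)) \<Longrightarrow>
      R \<in> syms V \<Longrightarrow> as \<in> M (RelSym R) \<Longrightarrow> set as \<subseteq> {1..n} \<Longrightarrow> length as = arity V R \<Longrightarrow> adm (map c as)"
  shows "M \<in> struct n ` samples n"
proof -
  define c where "c = restrict (\<lambda>a. THE i. i \<in> {1..l} \<and> has_colour M a i) {1..n}"
  have c: "c a \<in> {1..l} \<and> has_colour M a (c a)" if "a \<in> {1..n}" for a
    using theI'[OF col[rule_format, OF that]] that by (simp add: c_def)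
  have c_eq: "has_colour M a i \<longleftrightarrow> c a = i" if "a \<in> {1..n}" "i \<in> {1..l}" for a i
    using c[OF that(1)] col[rule_format, OF that(1)] that(2) by blast
  define W where "W = {(R, as). R \<in> syms V \<and> as \<in> M (RelSym R)}"
  have tuples: "set as \<subseteq> {1..n} \<and> length as = arity V R \<and> R \<in> syms V" if "as \<in> M (RelSym R)" for as R
    using M that unfolding in_structures_coloured by blast
  have colours: "as \<in> M (Colour i) \<longleftrightarrow> (\<exists>a\<in>{1..n}. as = [a] \<and> c a = i)" for as i
  proof
    assume as: "as \<in> M (Colour i)"
    then have "i \<in> {1..l}" "length as = 1" "set as \<subseteq> {1..n}"
      using M unfolding in_structures_coloured by blast+
    moreover from this obtain a where "as = [a]" by (auto simp: length_Suc_conv)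
    ultimately show "\<exists>a\<in>{1..n}. as = [a] \<and> c a = i"
      using as c_eq by (auto simp: has_colour_def)
  next
    assume "\<exists>a\<in>{1..n}. as = [a] \<and> c a = i"
    then show "as \<in> M (Colour i)" using c by (auto simp: has_colour_def)
  qed
  have "(c, W) \<in> samples n"
    using c tuples by (auto simp: samples_def W_def slots_def c_def[symmetric] PiE_iff extensional_def)
       (auto simp: c_def)
  moreover have "struct n (c, W) = M"
  proof
    fix s show "struct n (c, W) s = M s"
      using tuples adm[of c, OF c] colours
      by (cases s) (auto simp: struct_def rels_def W_def)
  qed
  ultimately show ?thesis by force
qed

section \<open>Sizes of the fibres of restriction\<close>

lemma restr_struct_eq_iff:
  "restr r (struct n \<omega>) = restr r (struct n \<omega>') \<longleftrightarrow>
    (\<forall>R as. card (set as) \<le> r \<longrightarrow> (as \<in> rels \<omega> R \<longleftrightarrow> as \<in> rels \<omega>' R)) \<and>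
    (r \<ge> 1 \<longrightarrow> (\<forall>a\<in>{1..n}. fst \<omega> a = fst \<omega>' a))"
  (is "?L \<longleftrightarrow> ?R")
proof
  assume L: ?L
  have eq: "as \<in> restr r (struct n \<omega>) s \<longleftrightarrow> as \<in> restr r (struct n \<omega>') s" for as s
    using L by simp
  show ?R
  proof (intro conjI allI impI ballI)
    fix R and as :: "nat list" assume "card (set as) \<le> r"
    then show "as \<in> rels \<omega> R \<longleftrightarrow> as \<in> rels \<omega>' R"
      using eq[of as "RelSym R"] by (auto simp: restr_def struct_def)
  next
    fix a assume "r \<ge> 1" "a \<in> {1..n}"
    then show "fst \<omega> a = fst \<omega>' a"
      using eq[of "[a]" "Colour (fst \<omega> a)"] by (auto simp: restr_def struct_def)
  qed
next
  assume R: ?R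
  show ?L
  proof
    fix s
    show "restr r (struct n \<omega>) s = restr r (struct n \<omega>') s"
      using R by (cases s) (auto simp: restr_def struct_def)
  qed
qed

text \<open>Different colours sit on different elements. Hence coins matter only from dimension 2
  on, when dimension 1 has already fixed the colouring.\<close>

lemma rels_not_unary:
  assumes "\<omega> \<in> samples n" "as \<in> rels \<omega> R"
  shows "card (set as) \<ge> 2"
proof -
  have "R \<in> syms V" "length as = arity V R" "adm (map (fst \<omega>) as)"
    using assms by (auto simp: samples_def rels_def slots_def)
  then have "card (fst \<omega> ` set as) \<ge> 2"
    using adm_not_constant[of "map (fst \<omega>) as"] arity_ge_2 by simp
  then show ?thesis
    using card_image_le[of "set as" "fst \<omega>"] by simp
qed

text \<open>Toggling the coins in which \<open>\<omega>\<close> and \<open>\<omega>'\<close> differ maps one fibre injectively into the other.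
  For \<open>r = 0\<close> the colouring changes, but then no coin is relevant.\<close>

lemma card_fibre_le:
  assumes \<omega>: "\<omega> \<in> samples n" and \<omega>': "\<omega>' \<in> samples n"
    and eq: "restr r (struct n \<omega>) = restr r (struct n \<omega>')"
  shows "card {z \<in> samples n. restr (Suc r) (struct n z) = restr (Suc r) (struct n \<omega>)} \<le>
    card {z \<in> samples n. restr (Suc r) (struct n z) = restr (Suc r) (struct n \<omega>')}"
proof -
  define D where "D = sym_diff (snd \<omega>) (snd \<omega>')"
  define g where "g z = (fst \<omega>', sym_diff (snd z) D)" for z :: "(nat \<Rightarrow> nat) \<times> ('r \<times> nat list) set"
  let ?F = "\<lambda>\<omega>. {z \<in> samples n. restr (Suc r) (struct n z) = restr (Suc r) (struct n \<omega>)}"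
  \<comment> \<open>Level \<open>Suc r\<close> is at least 1, so it sees the colours, and
    extensionality fixes the colouring outside the universe.\<close>
  have col: "fst z = fst \<omega>" if "z \<in> ?F \<omega>" for z
  proof (rule PiE_ext[of _ "{1..n}" "\<lambda>_. {1..l}"])
    show "fst z \<in> {1..n} \<rightarrow>\<^sub>E {1..l}" "fst \<omega> \<in> {1..n} \<rightarrow>\<^sub>E {1..l}"
      using that \<omega> by (auto simp: samples_def)
  qed (use that in \<open>auto simp: restr_struct_eq_iff\<close>)
  have "inj_on g (?F \<omega>)"
    using col by (intro inj_onI prod_eqI) (auto simp: g_def)
  moreover have "g ` ?F \<omega> \<subseteq> ?F \<omega>'"
  proof
    fix w assume "w \<in> g ` ?F \<omega>"
    then obtain z where z: "z \<in> ?F \<omega>" "w = g z" by auto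
    have w: "w \<in> samples n"
      using z \<omega> \<omega>' by (auto simp: samples_def g_def D_def)
    have "as \<in> rels w R \<longleftrightarrow> as \<in> rels \<omega>' R" if "card (set as) \<le> Suc r" for R as
    proof (cases "r = 0")
      case True
      then show ?thesis
        using rels_not_unary[OF w, of as R] rels_not_unary[OF \<omega>', of as R] that by auto
    next
      \<comment> \<open>All colourings agree now. At an inadmissible tuple neither structure has a
        relation; at an admissible one \<open>z\<close> and \<open>\<omega>\<close> have the same
        coin, which \<open>D\<close> turns into that of \<open>\<omega>'\<close>.\<close>
      case False
      have "fst \<omega> = fst \<omega>'"
        by (rule PiE_ext[of _ "{1..n}" "\<lambda>_. {1..l}"])
          (use \<omega> \<omega>' eq False in \<open>auto simp: samples_def restr_struct_eq_iff\<close>)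
      moreover have "as \<in> rels z R \<longleftrightarrow> as \<in> rels \<omega> R"
        using z that by (auto simp: restr_struct_eq_iff)
      ultimately show ?thesis
        using col[OF z(1)] by (auto simp: rels_def z(2) g_def D_def)
    qed
    then show "w \<in> ?F \<omega>'"
      using w by (auto simp: restr_struct_eq_iff z(2) g_def)
  qed
  moreover have "finite (?F \<omega>')" using finite_samples by simp
  ultimately show ?thesis by (rule card_inj_on_le)
qed

text \<open>From here on, probabilities are proportions of samples. Equality of fibre sizes comes
  from \<open>card_fibre_le\<close> in both directions.\<close>

lemma measure_dc_measure_struct:
  "measure (dc_measure (struct n ` samples n) (max_arity (coloured V l)))
     {M \<in> struct n ` samples n. P (reduct M)} =
   card {\<omega> \<in> samples n. P (rels \<omega>)} / card (samples n)"
proof -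
  have "measure (dc_measure (struct n ` samples n) (max_arity (coloured V l)))
     {M \<in> struct n ` samples n. P (reduct M)} =
     card {\<omega> \<in> samples n. P (reduct (struct n \<omega>))} / card (samples n)"
  proof (rule measure_dc_measure_image[OF finite_samples samples_nonempty])
    fix x y assume "x \<in> samples n" "y \<in> samples n"
    then have "as \<notin> rels x R \<and> as \<notin> rels y R" if "card (set as) \<le> 0" for as R
      using rels_not_unary[of x n as R] rels_not_unary[of y n as R] that by linarith
    then show "restr 0 (struct n x) = restr 0 (struct n y)"
      unfolding restr_struct_eq_iff by (intro conjI) (blast, simp)
  next
    fix r x y assume "x \<in> samples n" "y \<in> samples n" "restr r (struct n x) = restr r (struct n y)"
    then show "card {z \<in> samples n. restr (Suc r) (struct n z) = restr (Suc r) (struct n x)} =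
      card {z \<in> samples n. restr (Suc r) (struct n z) = restr (Suc r) (struct n y)}"
      by (intro order_antisym card_fibre_le) auto
  next
    fix x assume "x \<in> samples n"
    then show "restr (max_arity (coloured V l)) (struct n x) = struct n x"
      using restr_max_arity[OF finite_syms_coloured[OF fin_syms] struct_in_structures] by blast
  qed
  then show ?thesis by simp
qed

section \<open>One-point extensions and back-and-forth\<close>

text \<open>The element \<open>0\<close>, which is outside every universe, stands for the point to be added to \<open>S\<close>.\<close>

definition new_slots :: "nat set \<Rightarrow> ('r \<times> nat list) set" where
  "new_slots S = {p \<in> slots (insert 0 S). 0 \<in> set (snd p)}"

definition plug :: "nat \<Rightarrow> 'r \<times> nat list \<Rightarrow> 'r \<times> nat list" where
  "plug b p = (fst p, map (id(0 := b)) (snd p))"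

text \<open>\<open>T\<close> prescribes coins rather than relations, so for fixed \<open>S\<close>
  in the universe and \<open>b\<close> in the universe outside \<open>S\<close> the proportion of
  realizing samples does not depend on the colours of \<open>S\<close>.\<close>

definition realizes ::
  "nat set \<Rightarrow> nat \<Rightarrow> ('r \<times> nat list) set \<Rightarrow> (nat \<Rightarrow> nat) \<times> ('r \<times> nat list) set \<Rightarrow> nat \<Rightarrow> bool" where
  "realizes S i T \<omega> b \<longleftrightarrow> fst \<omega> b = i \<and> (\<forall>p\<in>new_slots S. plug b p \<in> snd \<omega> \<longleftrightarrow> p \<in> T)"

definition extension_property :: "nat \<Rightarrow> nat \<Rightarrow> (nat \<Rightarrow> nat) \<times> ('r \<times> nat list) set \<Rightarrow> bool" where
  "extension_property k n \<omega> \<longleftrightarrow>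
     (\<forall>S i T. S \<subseteq> {1..n} \<and> card S \<le> k \<and> i \<in> {1..l} \<and> T \<subseteq> new_slots S \<longrightarrow>
        (\<exists>b\<in>{1..n} - S. realizes S i T \<omega> b))"

text \<open>Colours are matched although sentences cannot mention them: they decide whether a
  successful coin yields a relation when a point is added.\<close>

definition partial_iso ::
  "nat set \<Rightarrow> (nat \<Rightarrow> nat) \<times> ('r \<times> nat list) set \<Rightarrow> (nat \<Rightarrow> nat) \<Rightarrow>
   (nat \<Rightarrow> nat) \<times> ('r \<times> nat list) set \<Rightarrow> (nat \<Rightarrow> nat) \<Rightarrow> bool" where
  "partial_iso F \<omega> e \<omega>' e' \<longleftrightarrow>
     (\<forall>x\<in>F. \<forall>y\<in>F. e x = e y \<longleftrightarrow> e' x = e' y) \<and>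
     (\<forall>x\<in>F. fst \<omega> (e x) = fst \<omega>' (e' x)) \<and>
     (\<forall>R\<in>syms V. \<forall>xs. set xs \<subseteq> F \<longrightarrow> length xs = arity V R \<longrightarrow>
        (map e xs \<in> rels \<omega> R \<longleftrightarrow> map e' xs \<in> rels \<omega>' R))"

lemma partial_iso_sym: "partial_iso F \<omega> e \<omega>' e' \<Longrightarrow> partial_iso F \<omega>' e' \<omega> e"
  unfolding partial_iso_def by metis

lemma partial_iso_subset: "partial_iso F \<omega> e \<omega>' e' \<Longrightarrow> G \<subseteq> F \<Longrightarrow> partial_iso G \<omega> e \<omega>' e'"
  unfolding partial_iso_def by (meson subset_iff)

lemma partial_iso_update_outside:
  assumes "partial_iso F \<omega> e \<omega>' e'" "x \<notin> F"
  shows "partial_iso F \<omega> (e(x := a)) \<omega>' (e'(x := b))"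
proof -
  have "map (f(x := z)) xs = map f xs" if "set xs \<subseteq> F" for f :: "nat \<Rightarrow> nat" and z xs
    using that assms(2) by (auto intro: map_cong)
  note upd = this
  show ?thesis
    unfolding partial_iso_def
  proof (intro conjI ballI allI impI)
    fix R xs assume "R \<in> syms V" "set xs \<subseteq> F" "length xs = arity V R"
    then show "map (e(x := a)) xs \<in> rels \<omega> R \<longleftrightarrow> map (e'(x := b)) xs \<in> rels \<omega>' R"
      using assms(1) by (simp only: upd partial_iso_def)
  qed (use assms in \<open>auto simp: partial_iso_def\<close>)
qed

text \<open>If \<open>a\<close> is an old value, its old partner serves again. Otherwise the
  relations between \<open>a\<close> and \<open>e\<close> F\<open>are transported to\<close>e'
  \<open>F\<close>, and the extension property supplies a point with these relations and the colour
  of \<open>a\<close>.\<close>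

lemma partial_iso_extend:
  assumes pi: "partial_iso F \<omega> e \<omega>' e'" and F: "finite F" "card F \<le> k" "x \<notin> F"
    and e: "e ` F \<subseteq> {1..n}" "e' ` F \<subseteq> {1..n'}"
    and \<omega>: "\<omega> \<in> samples n" "a \<in> {1..n}" and ext: "extension_property k n' \<omega>'"
  shows "\<exists>b\<in>{1..n'}. partial_iso (insert x F) \<omega> (e(x := a)) \<omega>' (e'(x := b))"
proof (cases "a \<in> e ` F")
  case True
  then obtain y where y: "y \<in> F" "a = e y" by auto
  \<comment> \<open>Sending \<open>x\<close> to \<open>y\<close> turns both updates into
    compositions with \<open>r\<close>, and partial isomorphisms pull back along
    \<open>r\<close>.\<close>
  define r where "r = id(x := y)"
  have upd: "f(x := f y) = f \<circ> r" for f :: "nat \<Rightarrow> nat" by (auto simp: r_def)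
  have r: "r z \<in> F" if "z \<in> insert x F" for z using that y by (auto simp: r_def)
  have "partial_iso (insert x F) \<omega> (e \<circ> r) \<omega>' (e' \<circ> r)"
    unfolding partial_iso_def
  proof (intro conjI ballI allI impI)
    fix z w assume "z \<in> insert x F" "w \<in> insert x F"
    then show "(e \<circ> r) z = (e \<circ> r) w \<longleftrightarrow> (e' \<circ> r) z = (e' \<circ> r) w"
      using pi r unfolding partial_iso_def by simp
  next
    fix z assume "z \<in> insert x F"
    then show "fst \<omega> ((e \<circ> r) z) = fst \<omega>' ((e' \<circ> r) z)"
      using pi r unfolding partial_iso_def by simp
  next
    fix R xs assume "R \<in> syms V" "set xs \<subseteq> insert x F" "length xs = arity V R"
    moreover from this have "set (map r xs) \<subseteq> F" using r by auto
    ultimately have "map e (map r xs) \<in> rels \<omega> R \<longleftrightarrow> map e' (map r xs) \<in> rels \<omega>' R"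
      using pi unfolding partial_iso_def by (metis length_map)
    then show "map (e \<circ> r) xs \<in> rels \<omega> R \<longleftrightarrow> map (e' \<circ> r) xs \<in> rels \<omega>' R" by simp
  qed
  then show ?thesis using y e upd by (intro bexI[of _ "e' y"]) auto
next
  case False
  define S where "S = e' ` F"
  \<comment> \<open>The inverse of the partial isomorphism, with the placeholder 0 going to
    \<open>a\<close>. The choice of preimage is harmless because \<open>e\<close> and
    \<open>e'\<close> identify the same variables of \<open>F\<close>.\<close>
  define h where "h = (\<lambda>z. e (inv_into F e' z))(0 := a)"
  have nz: "e' y \<noteq> 0" if "y \<in> F" for y using e that by fastforce
  have h: "h (e' y) = e y" if "y \<in> F" for y
  proof -
    have "inv_into F e' (e' y) \<in> F" "e' (inv_into F e' (e' y)) = e' y"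
      using that by (auto intro: inv_into_into f_inv_into_f)
    then show ?thesis using pi that nz[OF that] unfolding partial_iso_def h_def by auto
  qed
  \<comment> \<open>A coin is requested exactly where the relation holds in \<open>\<omega>\<close>.
    Since the colours agree, a requested coin is also admissible in
    \<open>\<omega>'\<close>.\<close>
  define T where "T = {p \<in> new_slots S. map h (snd p) \<in> rels \<omega> (fst p)}"
  have "card S \<le> k" using F card_image_le[of F e'] by (simp add: S_def)
  moreover have "fst \<omega> a \<in> {1..l}" using \<omega> by (auto simp: samples_def)
  moreover have "S \<subseteq> {1..n'}" "T \<subseteq> new_slots S" using e by (auto simp: S_def T_def)
  ultimately obtain b where b: "b \<in> {1..n'} - S" "realizes S (fst \<omega> a) T \<omega>' b"
    using ext unfolding extension_property_def by blast
  have col: "fst \<omega> ((e(x := a)) z) = fst \<omega>' ((e'(x := b)) z)" if "z \<in> insert x F" for z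
    using that pi b unfolding partial_iso_def realizes_def by auto
  have "partial_iso (insert x F) \<omega> (e(x := a)) \<omega>' (e'(x := b))"
    unfolding partial_iso_def
  proof (intro conjI ballI allI impI)
    fix z w assume "z \<in> insert x F" "w \<in> insert x F"
    moreover have "e z \<noteq> a" "e' z \<noteq> b" if "z \<in> F" for z
      using that False b by (auto simp: S_def)
    moreover have "e z = e w \<longleftrightarrow> e' z = e' w" if "z \<in> F" "w \<in> F"
      using pi that unfolding partial_iso_def by blast
    ultimately show "(e(x := a)) z = (e(x := a)) w \<longleftrightarrow> (e'(x := b)) z = (e'(x := b)) w"
      by (metis (no_types) fun_upd_apply insert_iff)
  next
    fix z assume "z \<in> insert x F"
    then show "fst \<omega> ((e(x := a)) z) = fst \<omega>' ((e'(x := b)) z)" by (rule col)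
  next
    fix R xs assume R: "R \<in> syms V" and xs: "set xs \<subseteq> insert x F" "length xs = arity V R"
    show "map (e(x := a)) xs \<in> rels \<omega> R \<longleftrightarrow> map (e'(x := b)) xs \<in> rels \<omega>' R"
    proof (cases "x \<in> set xs")
      case False
      then have "set xs \<subseteq> F" using xs by auto
      then show ?thesis
        using partial_iso_update_outside[OF pi F(3)] R xs unfolding partial_iso_def by blast
    next
      case True
      define p where "p = (R, map (e'(x := 0)) xs)"
      have p: "p \<in> new_slots S"
        using R xs True by (auto simp: p_def new_slots_def slots_def S_def)
      have "h ((e'(x := 0)) z) = (e(x := a)) z" "(id(0 := b)) ((e'(x := 0)) z) = (e'(x := b)) z"
        "fst \<omega> ((e(x := a)) z) = fst \<omega>' ((e'(x := b)) z)" if "z \<in> set xs" for z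
        using that xs(1) h[of z] nz[of z] col[of z] by (cases "z = x"; force simp: h_def)+
      then have "map h (snd p) = map (e(x := a)) xs" "plug b p = (R, map (e'(x := b)) xs)"
        "map (fst \<omega>) (map (e(x := a)) xs) = map (fst \<omega>') (map (e'(x := b)) xs)"
        unfolding p_def plug_def by (simp_all del: fun_upd_apply map_fun_upd)
      moreover have "plug b p \<in> snd \<omega>' \<longleftrightarrow> p \<in> T"
        using b p unfolding realizes_def by blast
      ultimately show ?thesis
        using p by (auto simp: T_def rels_def p_def simp del: map_map map_fun_upd)
    qed
  qed
  then show ?thesis using b by blast
qed

text \<open>Induction on the formula. A quantifier adds at most one point to the domain and uses up
  one unit of rank, so \<open>card F + qrank \<phi>\<close> stays within the budget
  \<open>k\<close>.\<close>

lemma sat_partial_iso: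
  assumes "partial_iso F \<omega> e \<omega>' e'" "finite F" "fvars \<phi> \<subseteq> F" "card F + qrank \<phi> \<le> k" "wff V \<phi>"
    and "e ` F \<subseteq> {1..n}" "e' ` F \<subseteq> {1..n'}"
    and \<omega>: "\<omega> \<in> samples n" "extension_property k n \<omega>"
    and \<omega>': "\<omega>' \<in> samples n'" "extension_property k n' \<omega>'"
  shows "sat {1..n} (rels \<omega>) e \<phi> \<longleftrightarrow> sat {1..n'} (rels \<omega>') e' \<phi>"
  using assms(1-7)
proof (induction \<phi> arbitrary: F e e')
  case (Ex x \<phi>)
  \<comment> \<open>The variable \<open>x\<close> may already lie in \<open>F\<close>; its old value
    is forgotten before it is bound anew.\<close>
  define G where "G = F - {x}"
  have pi: "partial_iso G \<omega> e \<omega>' e'"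
    using Ex.prems(1) by (rule partial_iso_subset) (simp add: G_def)
  have G: "finite G" "x \<notin> G" "card G \<le> card F"
    using Ex.prems(2) by (auto simp: G_def intro: card_mono)
  have eG: "e ` G \<subseteq> {1..n}" "e' ` G \<subseteq> {1..n'}" using Ex.prems(6,7) by (auto simp: G_def)
  have k: "card G \<le> k" "card (insert x G) + qrank \<phi> \<le> k" using G Ex.prems(4) by auto
  have IH: "sat {1..n} (rels \<omega>) (e(x := a)) \<phi> \<longleftrightarrow> sat {1..n'} (rels \<omega>') (e'(x := b)) \<phi>"
    if "partial_iso (insert x G) \<omega> (e(x := a)) \<omega>' (e'(x := b))" "a \<in> {1..n}" "b \<in> {1..n'}" for a b
  proof (rule Ex.IH[OF that(1) _ _ k(2)])
    show "fvars \<phi> \<subseteq> insert x G" using Ex.prems(3) by (auto simp: G_def)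
    show "(e(x := a)) ` insert x G \<subseteq> {1..n}" "(e'(x := b)) ` insert x G \<subseteq> {1..n'}"
      using that eG by (auto simp: image_subset_iff)
  qed (use Ex.prems G in auto)
  have "\<exists>b\<in>{1..n'}. partial_iso (insert x G) \<omega> (e(x := a)) \<omega>' (e'(x := b))" if "a \<in> {1..n}" for a
    by (rule partial_iso_extend[OF pi G(1) k(1) G(2) eG \<omega>(1) that \<omega>'(2)])
  moreover have "\<exists>a\<in>{1..n}. partial_iso (insert x G) \<omega> (e(x := a)) \<omega>' (e'(x := b))"
    if "b \<in> {1..n'}" for b
    using partial_iso_extend[OF partial_iso_sym[OF pi] G(1) k(1) G(2) eG(2,1) \<omega>'(1) that \<omega>(2)]
    by (blast intro: partial_iso_sym)
  ultimately have "(\<exists>a\<in>{1..n}. sat {1..n} (rels \<omega>) (e(x := a)) \<phi>) \<longleftrightarrow>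
      (\<exists>b\<in>{1..n'}. sat {1..n'} (rels \<omega>') (e'(x := b)) \<phi>)"
    using IH by meson
  then show ?case by (simp only: sat.simps)
qed (auto simp: partial_iso_def)

lemma models_iff:
  assumes \<phi>: "\<phi> \<in> sentences V"
    and \<omega>: "\<omega> \<in> samples n" "extension_property (qrank \<phi>) n \<omega>"
    and \<omega>': "\<omega>' \<in> samples n'" "extension_property (qrank \<phi>) n' \<omega>'"
  shows "models n (rels \<omega>) \<phi> \<longleftrightarrow> models n' (rels \<omega>') \<phi>"
proof -
  have "sat {1..n} (rels \<omega>) e \<phi> \<longleftrightarrow> sat {1..n'} (rels \<omega>') e' \<phi>" for e e'
  proof (rule sat_partial_iso[OF _ _ _ _ _ _ _ \<omega> \<omega>'])
    \<comment> \<open>No symbol is nullary, so the empty map has no relation to preserve.\<close>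
    show "partial_iso {} \<omega> e \<omega>' e'" by (auto simp: partial_iso_def dest: arity_ge_2)
  qed (use \<phi> in \<open>auto simp: sentences_def\<close>)
  \<comment> \<open>\<open>models\<close> would hold vacuously over an empty universe; the extension
    property for the empty set rules this out.\<close>
  moreover have "\<exists>e. range e \<subseteq> {1..m}"
    if "extension_property (qrank \<phi>) m \<eta>" for m :: nat and \<eta>
  proof -
    have "\<exists>b\<in>{1..m} - {}. realizes {} 1 {} \<eta> b"
      using that[unfolded extension_property_def, rule_format, of "{}" 1 "{}"] l_ge_2 by simp
    then obtain b where "b \<in> {1..m}" by auto
    then show ?thesis by (intro exI[of _ "\<lambda>_. b"]) auto
  qed
  ultimately show ?thesis
    unfolding models_def using \<omega>(2) \<omega>'(2) by metis
qed

section \<open>Proportion of samples without the extension property\<close>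

definition unrealized where
  "unrealized n S i T B = {\<omega> \<in> samples n. \<forall>b\<in>B. \<not> realizes S i T \<omega> b}"

lemma set_plug:
  assumes "p \<in> new_slots S"
  shows "set (snd (plug b p)) \<subseteq> insert b S" and "b \<in> set (snd (plug b p))"
proof -
  have "set (snd p) \<subseteq> insert 0 S" "0 \<in> set (snd p)"
    using assms by (auto simp: new_slots_def slots_def)
  then show "set (snd (plug b p)) \<subseteq> insert b S" "b \<in> set (snd (plug b p))"
    unfolding plug_def by (force simp: image_iff)+
qed

lemma plug_in_slots:
  assumes "S \<subseteq> {1..n}" "b \<in> {1..n}" "p \<in> new_slots S"
  shows "plug b p \<in> slots {1..n}"
proof -
  have "set (snd (plug b p)) \<subseteq> {1..n}" using set_plug(1)[OF assms(3)] assms by blast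
  moreover have "fst p \<in> syms V" "length (snd p) = arity V (fst p)"
    using assms(3) by (auto simp: new_slots_def slots_def)
  ultimately show ?thesis by (simp add: slots_def plug_def)
qed

text \<open>Distinct slots thus use distinct coins at \<open>b\<close>, so every pattern
  \<open>T\<close> can be prescribed there.\<close>

lemma inj_on_plug:
  assumes "b \<notin> S" "b \<noteq> 0"
  shows "inj_on (plug b) (new_slots S)"
proof -
  have "inj_on (id(0 := b)) (insert 0 S)"
    using assms by (auto simp: inj_on_def)
  then have "as = bs" if "map (id(0 := b)) as = map (id(0 := b)) bs"
    "set as \<subseteq> insert 0 S" "set bs \<subseteq> insert 0 S" for as bs
    using that inj_on_subset[of "id(0 := b)" "insert 0 S" "set as \<union> set bs"]
    by (auto simp: inj_on_map_eq_map)
  moreover have "set (snd p) \<subseteq> insert 0 S" if "p \<in> new_slots S" for p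
    using that by (auto simp: new_slots_def slots_def)
  ultimately show ?thesis
    unfolding inj_on_def plug_def by (metis prod.collapse prod.inject)
qed

text \<open>Overwriting the colour of \<open>b\<close> and the coins of the tuples through \<open>b\<close> sends every sample to
  one in which \<open>b\<close> realizes the type, and at most \<open>l * 2 ^ card (new_slots S)\<close> samples have the
  same image.\<close>

lemma card_unrealized_insert:
  assumes S: "S \<subseteq> {1..n}" and i: "i \<in> {1..l}" and T: "T \<subseteq> new_slots S"
    and b: "b \<in> {1..n}" "b \<notin> S" "b \<notin> B" and B: "B \<inter> S = {}"
  shows "real (card (unrealized n S i T (insert b B))) \<le>
    (1 - 1 / (l * 2 ^ card (new_slots S))) * card (unrealized n S i T B)"
proof -
  define N where "N = l * 2 ^ card (new_slots S)"
  define A where "A = unrealized n S i T B"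
  define R where "R = {\<omega> \<in> A. realizes S i T \<omega> b}"
  define Q where "Q = plug b ` new_slots S"
  \<comment> \<open>The second component of \<open>g\<close> stores the overwritten data, which
    makes \<open>g\<close> injective.\<close>
  define g where "g \<omega> = (((fst \<omega>)(b := i), (snd \<omega> - Q) \<union> plug b ` T), (fst \<omega> b, snd \<omega> \<inter> Q))"
    for \<omega> :: "(nat \<Rightarrow> nat) \<times> ('r \<times> nat list) set"
  have finS: "finite S" using S finite_subset by blast
  have fin_new: "finite (new_slots S)"
    using finite_slots[of "insert 0 S"] finS by (simp add: new_slots_def)
  have finA: "finite A" using finite_samples by (simp add: A_def unrealized_def)
  have TQ: "plug b ` T \<subseteq> Q" using T by (auto simp: Q_def)
  have "inj_on g A"
  proof (rule inj_onI)
    fix \<omega> \<omega>' assume eq: "g \<omega> = g \<omega>'"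
    have "A = (A \<inter> Q) \<union> ((A - Q \<union> plug b ` T) - Q)" for A using TQ by blast
    then have "snd \<omega> = snd \<omega>'" using eq unfolding g_def by (metis prod.inject)
    moreover have "fst \<omega> = fst \<omega>'"
      using eq by (auto simp: g_def fun_eq_iff) metis
    ultimately show "\<omega> = \<omega>'" by (simp add: prod_eq_iff)
  qed
  moreover have "g ` A \<subseteq> R \<times> ({1..l} \<times> Pow Q)"
  proof
    fix z assume "z \<in> g ` A"
    then obtain \<omega> where \<omega>: "\<omega> \<in> A" "z = g \<omega>" by auto
    then have \<omega>s: "\<omega> \<in> samples n" by (simp add: A_def unrealized_def)
    have "plug b ` T \<subseteq> slots {1..n}" using T plug_in_slots[OF S b(1)] by auto
    then have zs: "fst z \<in> samples n"
      using \<omega>s i b by (auto simp: \<omega>(2) g_def samples_def PiE_iff extensional_def)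
    \<comment> \<open>Only coins of tuples with entries in \<open>insert b S\<close> were changed. A
      plugged tuple for \<open>b'\<close> contains \<open>b'\<close>, which lies outside that
      set.\<close>
    have other: "realizes S i T (fst z) b' \<longleftrightarrow> realizes S i T \<omega> b'" if "b' \<in> B" for b'
    proof -
      have "b' \<noteq> b" "b' \<notin> S" using that b B by auto
      have notQ: "plug b' p \<notin> Q" if "p \<in> new_slots S" for p
      proof
        assume "plug b' p \<in> Q"
        then obtain q where q: "q \<in> new_slots S" "plug b' p = plug b q" by (auto simp: Q_def)
        then have "b' \<in> insert b S"
          using set_plug(2)[OF that, of b'] set_plug(1)[OF q(1), of b] by auto
        then show False using \<open>b' \<noteq> b\<close> \<open>b' \<notin> S\<close> by auto
      qed
      have "plug b' p \<in> snd (fst z) \<longleftrightarrow> plug b' p \<in> snd \<omega>" if "p \<in> new_slots S" for p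
        using notQ[OF that] TQ unfolding \<omega>(2) g_def fst_conv snd_conv by blast
      moreover have "fst (fst z) b' = fst \<omega> b'"
        using \<open>b' \<noteq> b\<close> by (simp add: \<omega>(2) g_def)
      ultimately show ?thesis unfolding realizes_def by metis
    qed
    have "b \<noteq> 0" using b by simp
    then have "plug b p \<in> plug b ` T \<longleftrightarrow> p \<in> T" if "p \<in> new_slots S" for p
      using inj_on_plug[OF b(2)] T that by (intro inj_on_image_mem_iff) auto
    then have "plug b p \<in> snd (fst z) \<longleftrightarrow> p \<in> T" if "p \<in> new_slots S" for p
      using that unfolding \<omega>(2) g_def fst_conv snd_conv Q_def by blast
    then have "realizes S i T (fst z) b"
      unfolding realizes_def by (simp add: \<omega>(2) g_def)
    then have "fst z \<in> R"
      using zs other \<omega> by (auto simp: R_def A_def unrealized_def)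
    moreover have "snd z \<in> {1..l} \<times> Pow Q"
      using \<omega>s b by (auto simp: \<omega>(2) g_def samples_def)
    ultimately show "z \<in> R \<times> ({1..l} \<times> Pow Q)" by (simp add: mem_Times_iff)
  qed
  moreover have "finite (R \<times> ({1..l} \<times> Pow Q))"
    using finA fin_new by (simp add: R_def Q_def)
  ultimately have "card A \<le> card (R \<times> ({1..l} \<times> Pow Q))" by (rule card_inj_on_le)
  also have "\<dots> = card R * (l * 2 ^ card Q)"
    using fin_new by (simp add: card_cartesian_product card_Pow Q_def)
  also have "\<dots> \<le> card R * N"
    using fin_new card_image_le[of "new_slots S" "plug b"] by (simp add: N_def Q_def)
  finally have "real (card A) \<le> real (card R) * real N"
    by (metis of_nat_le_iff of_nat_mult)
  moreover have "N > 0" using l_ge_2 by (simp add: N_def)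
  \<comment> \<open>At least one \<open>N\<close>-th of \<open>A\<close> realizes the type at
    \<open>b\<close>; only the rest stays unrealized.\<close>
  ultimately have "real (card A) / N \<le> card R" by (simp add: field_simps)
  moreover have "unrealized n S i T (insert b B) = A - R"
    by (auto simp: A_def R_def unrealized_def)
  moreover have "card (A - R) = card A - card R" "card R \<le> card A"
    using finA by (auto simp: R_def intro: card_Diff_subset card_mono)
  ultimately show ?thesis
    by (simp add: A_def[symmetric] N_def[symmetric] algebra_simps of_nat_diff)
qed

text \<open>Candidates are added one by one, each costing one factor; this counting stands in for
  independence.\<close>

lemma card_unrealized:
  assumes S: "S \<subseteq> {1..n}" and i: "i \<in> {1..l}" and T: "T \<subseteq> new_slots S"
    and B: "finite B" "B \<subseteq> {1..n} - S"
  shows "real (card (unrealized n S i T B)) \<le>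
    (1 - 1 / (l * 2 ^ card (new_slots S))) ^ card B * card (samples n)"
  using B
proof (induction B rule: finite_induct)
  case empty
  then show ?case by (simp add: unrealized_def)
next
  case (insert b B)
  let ?q = "1 - 1 / (l * 2 ^ card (new_slots S)) :: real"
  have "real l * 2 ^ card (new_slots S) \<ge> 1 * 1"
    using l_ge_2 by (intro mult_mono) auto
  then have q: "?q \<ge> 0" by simp
  have "real (card (unrealized n S i T (insert b B))) \<le> ?q * card (unrealized n S i T B)"
    using insert by (intro card_unrealized_insert[OF S i T]) auto
  also have "\<dots> \<le> ?q * (?q ^ card B * card (samples n))"
    using insert q by (intro mult_left_mono) auto
  finally show ?case using insert by simp
qed

text \<open>Counts tuples over \<open>Suc k\<close> points: up to \<open>k\<close> from
  \<open>S\<close>, and the placeholder. It is uniform in \<open>S\<close> and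
  \<open>n\<close>.\<close>

definition slot_bound :: "nat \<Rightarrow> nat" where
  "slot_bound k = (\<Sum>R\<in>syms V. Suc k ^ arity V R)"

lemma card_new_slots:
  assumes "finite S" "card S \<le> k"
  shows "finite (new_slots S)" "card (new_slots S) \<le> slot_bound k"
proof -
  show "finite (new_slots S)"
    using finite_slots[of "insert 0 S"] assms by (simp add: new_slots_def)
  have "card (new_slots S) \<le> card (slots (insert 0 S))"
    using finite_slots[of "insert 0 S"] assms by (intro card_mono) (auto simp: new_slots_def)
  also have "\<dots> = (\<Sum>R\<in>syms V. card (insert 0 S) ^ arity V R)"
    unfolding slots_def using fin_syms assms
    by (subst card_SigmaI) (auto simp: card_lists_length_eq intro: finite_lists_length_eq)
  also have "\<dots> \<le> slot_bound k"
    unfolding slot_bound_def using assms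
    by (intro sum_mono power_mono) (auto simp: card_insert_if)
  finally show "card (new_slots S) \<le> slot_bound k" .
qed

text \<open>Each such set is the set of entries of a list of length at most
  \<open>k\<close>.\<close>

lemma card_subsets_le:
  "card {S. S \<subseteq> {1..n::nat} \<and> card S \<le> k} \<le> (\<Sum>j\<le>k. n ^ j)"
proof -
  let ?L = "{xs. set xs \<subseteq> {1..n} \<and> length xs \<le> k}"
  have fin: "finite ?L" by (rule finite_lists_length_le) simp
  have "{S. S \<subseteq> {1..n} \<and> card S \<le> k} \<subseteq> set ` ?L"
  proof
    fix S assume "S \<in> {S. S \<subseteq> {1..n} \<and> card S \<le> k}"
    then have S: "S \<subseteq> {1..n}" "card S \<le> k" by auto
    then obtain xs where "set xs = S" "length xs = card S"
      using finite_distinct_list[of S] finite_subset[of S] by (auto dest: distinct_card)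
    then show "S \<in> set ` ?L" using S by force
  qed
  then have "card {S. S \<subseteq> {1..n} \<and> card S \<le> k} \<le> card ?L"
    using fin by (meson card_image_le card_mono finite_imageI le_trans)
  then show ?thesis by (simp add: card_lists_length_le)
qed

text \<open>A union bound over all triples \<open>(S, i, T)\<close>; each leaves at least
  \<open>n - k\<close> candidates outside \<open>S\<close>.\<close>

lemma card_no_extension_property:
  fixes k
  defines "N \<equiv> l * 2 ^ slot_bound k"
  assumes "k \<le> n"
  shows "real (card {\<omega> \<in> samples n. \<not> extension_property k n \<omega>}) \<le>
    real N * (\<Sum>j\<le>k. real n ^ j) * (1 - 1 / N) ^ (n - k) * card (samples n)"
proof -
  define \<S> where "\<S> = {S. S \<subseteq> {1..n} \<and> card S \<le> k}"
  define I where "I = Sigma \<S> (\<lambda>S. {1..l} \<times> Pow (new_slots S))"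
  define bad where "bad z = (case z of (S, i, T) \<Rightarrow> unrealized n S i T ({1..n} - S))" for z
  let ?b = "(1 - 1 / real N) ^ (n - k) * real (card (samples n))"
  have fin\<S>: "finite \<S>" by (simp add: \<S>_def)
  have fin_new: "finite (new_slots S)" "card (new_slots S) \<le> slot_bound k" if "S \<in> \<S>" for S
    using that card_new_slots[of S k] finite_subset[of S "{1..n}"] by (auto simp: \<S>_def)
  have finI: "finite I" unfolding I_def using fin\<S> fin_new by auto
  have "card I = (\<Sum>S\<in>\<S>. l * 2 ^ card (new_slots S))"
    unfolding I_def using fin\<S> fin_new
    by (subst card_SigmaI) (auto simp: card_cartesian_product card_Pow)
  also have "\<dots> \<le> (\<Sum>S\<in>\<S>. N)"
    unfolding N_def using fin_new by (intro sum_mono mult_left_mono power_increasing) auto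
  also have "\<dots> \<le> (\<Sum>j\<le>k. n ^ j) * N"
    using card_subsets_le[of n k] by (simp add: \<S>_def)
  finally have "real (card I) \<le> real ((\<Sum>j\<le>k. n ^ j) * N)" by (simp only: of_nat_le_iff)
  then have cardI: "real (card I) \<le> (\<Sum>j\<le>k. real n ^ j) * N" by simp
  have each: "real (card (bad z)) \<le> ?b" if "z \<in> I" for z
  proof -
    obtain S i T where z: "z = (S, i, T)" by (cases z)
    with that have S: "S \<in> \<S>" "S \<subseteq> {1..n}" "card S \<le> k" and i: "i \<in> {1..l}" and T: "T \<subseteq> new_slots S"
      by (auto simp: I_def \<S>_def)
    let ?q = "1 - 1 / (l * 2 ^ card (new_slots S)) :: real"
    let ?m = "card ({1..n} - S)"
    have lo: "real l * 2 ^ card (new_slots S) \<ge> 1 * 1"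
      using l_ge_2 by (intro mult_mono) auto
    have "real l * 2 ^ card (new_slots S) \<le> real N"
      using fin_new[OF S(1)] by (auto simp: N_def intro!: mult_left_mono power_increasing)
    then have "?q \<le> 1 - 1 / N"
      using lo by (simp add: frac_le)
    moreover have q: "0 \<le> ?q" using lo by simp
    moreover have "n - k \<le> ?m"
      using S finite_subset[OF S(2)] by (simp add: card_Diff_subset)
    moreover have "?q \<le> 1" by simp
    \<comment> \<open>Enlarging the base and, as \<open>?q\<close> lies between 0 and 1, lowering
      the exponent both increase the power; the result no longer depends on
      \<open>S\<close>.\<close>
    ultimately have "?q ^ ?m \<le> (1 - 1 / N) ^ (n - k)"
      by (meson order_trans power_decreasing power_mono)
    then have "?q ^ ?m * card (samples n) \<le> ?b" by (simp add: mult_right_mono)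
    moreover have "real (card (bad z)) \<le> ?q ^ ?m * card (samples n)"
      using card_unrealized[OF S(2) i T, of "{1..n} - S"] by (simp add: bad_def z)
    ultimately show ?thesis by linarith
  qed
  have "{\<omega> \<in> samples n. \<not> extension_property k n \<omega>} \<subseteq> (\<Union>z\<in>I. bad z)"
    unfolding extension_property_def I_def bad_def \<S>_def unrealized_def by fastforce
  then have "card {\<omega> \<in> samples n. \<not> extension_property k n \<omega>} \<le> card (\<Union>z\<in>I. bad z)"
    using finI finite_samples by (intro card_mono) (auto simp: bad_def unrealized_def)
  also have "\<dots> \<le> (\<Sum>z\<in>I. card (bad z))" using finI by (rule card_UN_le)
  finally have "real (card {\<omega> \<in> samples n. \<not> extension_property k n \<omega>}) \<le> real (\<Sum>z\<in>I. card (bad z))"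
    by (simp only: of_nat_le_iff)
  also have "\<dots> = (\<Sum>z\<in>I. real (card (bad z)))" by simp
  also have "\<dots> \<le> (\<Sum>z\<in>I. ?b)" by (intro sum_mono each)
  also have "\<dots> = card I * ?b" by simp
  also have "\<dots> \<le> ((\<Sum>j\<le>k. real n ^ j) * N) * ?b"
  proof (rule mult_right_mono[OF cardI])
    have "N > 0" using l_ge_2 by (simp add: N_def)
    then show "0 \<le> ?b" by simp
  qed
  finally show ?thesis by (simp add: mult_ac)
qed

lemma no_extension_property_tendsto_0:
  "(\<lambda>n. card {\<omega> \<in> samples n. \<not> extension_property k n \<omega>} / card (samples n)) \<longlonglongrightarrow> 0"
proof -
  define N where "N = l * 2 ^ slot_bound k"
  define q where "q = 1 - 1 / real N"
  \<comment> \<open>This gives \<open>q > 0\<close>, so that \<open>q ^ (n - k)\<close> can be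
    written with a division by \<open>q ^ k\<close>.\<close>
  have "N \<ge> 2" using l_ge_2 mult_mono[of 2 l 1 "2 ^ slot_bound k"] by (simp add: N_def)
  then have q: "0 < q" "q < 1" by (auto simp: q_def)
  have "(\<lambda>n. real N * (\<Sum>j\<le>k. real n ^ j * q ^ n) * (1 / q ^ k)) \<longlonglongrightarrow> real N * (\<Sum>j\<le>k. 0) * (1 / q ^ k)"
    using q by (intro tendsto_intros) real_asymp
  then have lim: "(\<lambda>n. real N * (\<Sum>j\<le>k. real n ^ j * q ^ n) * (1 / q ^ k)) \<longlonglongrightarrow> 0" by simp
  show ?thesis
  proof (rule tendsto_sandwich[OF _ _ tendsto_const lim])
    have "card {\<omega> \<in> samples n. \<not> extension_property k n \<omega>} / card (samples n) \<le>
      real N * (\<Sum>j\<le>k. real n ^ j * q ^ n) * (1 / q ^ k)" if "n \<ge> k" for n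
    proof -
      have "card (samples n) > 0" using finite_samples samples_nonempty by (simp add: card_gt_0_iff)
      moreover have "q ^ (n - k) = q ^ n / q ^ k" using q that by (simp add: power_diff)
      ultimately show ?thesis
        using card_no_extension_property[OF that]
        by (simp add: N_def[symmetric] q_def[symmetric] field_simps sum_distrib_left sum_distrib_right)
    qed
    then show "\<forall>\<^sub>F n in sequentially. card {\<omega> \<in> samples n. \<not> extension_property k n \<omega>} / card (samples n) \<le>
      real N * (\<Sum>j\<le>k. real n ^ j * q ^ n) * (1 / q ^ k)"
      unfolding eventually_sequentially by blast
  qed simp
qed

text \<open>All samples with the extension property agree on the sentence, even for different
  \<open>n\<close>. If one satisfies it, every sample refuting it lacks the property; if none does,
  every sample satisfying it lacks the property. Either way the exceptional proportion tends to
  0.\<close>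

theorem zero_one_law:
  assumes \<phi>: "\<phi> \<in> sentences V"
  defines "\<delta> \<equiv> (\<lambda>n. measure (dc_measure (struct n ` samples n) (max_arity (coloured V l)))
     {M \<in> struct n ` samples n. models n (reduct M) \<phi>})"
  shows "\<delta> \<longlonglongrightarrow> 0 \<or> \<delta> \<longlonglongrightarrow> 1"
proof -
  let ?E = "\<lambda>n. extension_property (qrank \<phi>) n"
  let ?\<epsilon> = "\<lambda>n. card {\<omega> \<in> samples n. \<not> ?E n \<omega>} / card (samples n)"
  have \<delta>: "\<delta> n = card {\<omega> \<in> samples n. models n (rels \<omega>) \<phi>} / card (samples n)" for n
    unfolding \<delta>_def by (rule measure_dc_measure_struct)
  have pos: "card (samples n) > 0" for n
    using finite_samples samples_nonempty by (simp add: card_gt_0_iff)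
  show ?thesis
  proof (cases "\<exists>n. \<exists>\<omega>\<in>samples n. ?E n \<omega> \<and> models n (rels \<omega>) \<phi>")
    case True
    then have sub: "{\<omega> \<in> samples n. \<not> models n (rels \<omega>) \<phi>} \<subseteq> {\<omega> \<in> samples n. \<not> ?E n \<omega>}" for n
      using models_iff[OF \<phi>] by blast
    have "1 - ?\<epsilon> n \<le> \<delta> n" and "\<delta> n \<le> 1" for n
    proof -
      let ?Y = "{\<omega> \<in> samples n. models n (rels \<omega>) \<phi>}"
      let ?Z = "{\<omega> \<in> samples n. \<not> models n (rels \<omega>) \<phi>}"
      have "card (?Y \<union> ?Z) = card ?Y + card ?Z"
        using finite_samples[of n] by (intro card_Un_disjoint) auto
      moreover have "?Y \<union> ?Z = samples n" by auto
      moreover have "card ?Z \<le> card {\<omega> \<in> samples n. \<not> ?E n \<omega>}"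
        using sub finite_samples[of n] by (intro card_mono) auto
      ultimately have "real (card (samples n)) \<le> card ?Y + card {\<omega> \<in> samples n. \<not> ?E n \<omega>}"
        "real (card ?Y) \<le> card (samples n)" by simp_all
      then show "1 - ?\<epsilon> n \<le> \<delta> n" "\<delta> n \<le> 1"
        using pos[of n] unfolding \<delta> by (simp_all add: diff_le_eq flip: add_divide_distrib)
    qed
    moreover have "(\<lambda>n. 1 - ?\<epsilon> n) \<longlonglongrightarrow> 1 - 0"
      by (intro tendsto_intros no_extension_property_tendsto_0)
    ultimately have "\<delta> \<longlonglongrightarrow> 1"
      by (intro tendsto_sandwich[of "\<lambda>n. 1 - ?\<epsilon> n" \<delta> sequentially "\<lambda>_. 1"]) auto
    then show ?thesis ..
  next
    case False
    have "\<delta> n \<le> ?\<epsilon> n" for n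
      unfolding \<delta> using False finite_samples[of n]
      by (intro divide_right_mono of_nat_mono card_mono) auto
    then have "\<delta> \<longlonglongrightarrow> 0"
      by (intro tendsto_sandwich[OF _ _ tendsto_const no_extension_property_tendsto_0[of "qrank \<phi>"]])
        (auto simp: \<delta>)
    then show ?thesis ..
  qed
qed

end

section \<open>The two classes of coloured structures\<close>

theorem theorem9p1:
  fixes L_rel :: "'r vocabulary" and l :: nat and \<phi> :: "'r fm"
  assumes "l \<ge> 2"
    and "finite (syms L_rel)" and "syms L_rel \<noteq> {}"
    and "\<forall>R\<in>syms L_rel. arity L_rel R \<ge> 2"
    and "\<phi> \<in> sentences L_rel"
  shows "((\<lambda>n. delta_C L_rel l n {M \<in> Cn L_rel l n. models n M \<phi>}) \<longlonglongrightarrow> 0 \<or>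
          (\<lambda>n. delta_C L_rel l n {M \<in> Cn L_rel l n. models n M \<phi>}) \<longlonglongrightarrow> 1) \<and>
         ((\<forall>R\<in>syms L_rel. arity L_rel R \<le> l) \<longrightarrow>
          (\<lambda>n. delta_S L_rel l n {M \<in> Sn L_rel l n. models n M \<phi>}) \<longlonglongrightarrow> 0 \<or>
          (\<lambda>n. delta_S L_rel l n {M \<in> Sn L_rel l n. models n M \<phi>}) \<longlonglongrightarrow> 1)"
proof -
  \<comment> \<open>For \<open>Kn\<close>, admissible means not monochromatic; for
    \<open>SKn\<close> below, all colours along the tuple are distinct.\<close>
  interpret K: admissible_colouring L_rel l "\<lambda>cs. \<exists>x\<in>set cs. \<exists>y\<in>set cs. x \<noteq> y"
  proof
    fix cs :: "nat list" assume "\<exists>x\<in>set cs. \<exists>y\<in>set cs. x \<noteq> y"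
    then obtain x y where "x \<noteq> y" "{x, y} \<subseteq> set cs" by auto
    then show "card (set cs) \<ge> 2" using card_mono[of "set cs" "{x, y}"] by simp
  qed (use assms in auto)
  interpret S: admissible_colouring L_rel l distinct
    by unfold_locales (use assms in \<open>auto simp: distinct_card\<close>)
  have Kn: "Kn L_rel l n = K.struct n ` K.samples n" for n
  proof
    show "Kn L_rel l n \<subseteq> K.struct n ` K.samples n"
    proof
      fix M assume M: "M \<in> Kn L_rel l n"
      show "M \<in> K.struct n ` K.samples n"
      proof (rule K.ex_struct)
        fix c R as
        assume c: "\<And>a. a \<in> {1..n} \<Longrightarrow> c a \<in> {1..l} \<and> has_colour M a (c a)"
          and as: "R \<in> syms L_rel" "as \<in> M (RelSym R)" "set as \<subseteq> {1..n}"
        then have "\<exists>a\<in>set as. \<exists>b\<in>set as. diff_colours l M a b"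
          using M unfolding Kn_def by blast
        then obtain a b i j where ab: "a \<in> set as" "b \<in> set as" "i \<in> {1..l}" "j \<in> {1..l}" "i \<noteq> j"
          "has_colour M a i" "has_colour M b j"
          unfolding diff_colours_def by blast
        moreover have "\<exists>!i. i \<in> {1..l} \<and> has_colour M x i" if "x \<in> set as" for x
          using that M as by (auto simp: Kn_def)
        \<comment> \<open>Every element has only one colour, so the witnesses \<open>i\<close> and
          \<open>j\<close> are \<open>c a\<close> and \<open>c b\<close>.\<close>
        ultimately have "c a \<noteq> c b" using c as(3) by (metis subsetD)
        then show "\<exists>x\<in>set (map c as). \<exists>y\<in>set (map c as). x \<noteq> y" using ab by auto
      qed (use M in \<open>auto simp: Kn_def\<close>)
    qed
    show "K.struct n ` K.samples n \<subseteq> Kn L_rel l n"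
    proof
      fix M assume "M \<in> K.struct n ` K.samples n"
      then obtain \<omega> where \<omega>: "\<omega> \<in> K.samples n" "M = K.struct n \<omega>" by auto
      have "\<exists>a\<in>set as. \<exists>b\<in>set as. diff_colours l M a b" if "as \<in> M (RelSym R)" for R as
      proof -
        have as: "as \<in> K.rels \<omega> R" using that by (simp add: \<omega>(2) K.struct_def)
        then have "set as \<subseteq> {1..n}" using \<omega>(1) by (auto simp: K.samples_def K.rels_def K.slots_def)
        moreover obtain a b where "a \<in> set as" "b \<in> set as" "fst \<omega> a \<noteq> fst \<omega> b"
          using as by (auto simp: K.rels_def)
        ultimately show ?thesis
          using K.diff_colours_struct[OF \<omega>(1)] \<omega>(2) by blast
      qed
      then show "M \<in> Kn L_rel l n"
        using \<omega> K.struct_in_structures K.ex1_colour_struct by (auto simp: Kn_def)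
    qed
  qed
  have SKn: "SKn L_rel l n = S.struct n ` S.samples n" for n
  proof
    show "SKn L_rel l n \<subseteq> S.struct n ` S.samples n"
    proof
      fix M assume M: "M \<in> SKn L_rel l n"
      show "M \<in> S.struct n ` S.samples n"
      proof (rule S.ex_struct)
        fix c R as
        assume c: "\<And>a. a \<in> {1..n} \<Longrightarrow> c a \<in> {1..l} \<and> has_colour M a (c a)"
          and as: "R \<in> syms L_rel" "as \<in> M (RelSym R)" "set as \<subseteq> {1..n}"
        have "c (as ! p) \<noteq> c (as ! q)" if pq: "p < length as" "q < length as" "p \<noteq> q" for p q
        proof -
          have "diff_colours l M (as ! p) (as ! q)"
            using M as pq unfolding SKn_def by blast
          then obtain i j where "i \<in> {1..l}" "j \<in> {1..l}" "i \<noteq> j"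
            "has_colour M (as ! p) i" "has_colour M (as ! q) j"
            unfolding diff_colours_def by blast
          moreover have "\<exists>!i. i \<in> {1..l} \<and> has_colour M x i" if "x \<in> set as" for x
            using that M as by (auto simp: SKn_def)
          ultimately show ?thesis using c as(3) pq by (metis subsetD nth_mem)
        qed
        then show "distinct (map c as)" by (simp add: distinct_conv_nth)
      qed (use M in \<open>auto simp: SKn_def\<close>)
    qed
    show "S.struct n ` S.samples n \<subseteq> SKn L_rel l n"
    proof
      fix M assume "M \<in> S.struct n ` S.samples n"
      then obtain \<omega> where \<omega>: "\<omega> \<in> S.samples n" "M = S.struct n \<omega>" by auto
      have "diff_colours l M (as ! p) (as ! q)"
        if "as \<in> M (RelSym R)" "p < length as" "q < length as" "p \<noteq> q" for R as p q
      proof -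
        have as: "as \<in> S.rels \<omega> R" using that by (simp add: \<omega>(2) S.struct_def)
        then have "set as \<subseteq> {1..n}" using \<omega>(1) by (auto simp: S.samples_def S.rels_def S.slots_def)
        then have "as ! p \<in> {1..n}" "as ! q \<in> {1..n}" using that nth_mem by blast+
        then show ?thesis
          using as that S.diff_colours_struct[OF \<omega>(1)]
          by (auto simp: S.rels_def \<omega>(2) distinct_conv_nth)
      qed
      then show "M \<in> SKn L_rel l n"
        using \<omega> S.struct_in_structures S.ex1_colour_struct by (auto simp: SKn_def)
    qed
  qed
  \<comment> \<open>Reducts of members of \<open>Kn\<close> lie in \<open>Cn\<close> automatically,
    so only satisfaction of the sentence remains.\<close>
  have "delta_C L_rel l n {M \<in> Cn L_rel l n. models n M \<phi>} =
      measure (dc_measure (K.struct n ` K.samples n) (max_arity (coloured L_rel l)))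
        {M \<in> K.struct n ` K.samples n. models n (reduct M) \<phi>}" for n
    unfolding delta_C_def delta_K_def Cn_def Kn by (rule arg_cong[where f = "measure _"]) auto
  moreover have "delta_S L_rel l n {M \<in> Sn L_rel l n. models n M \<phi>} =
      measure (dc_measure (S.struct n ` S.samples n) (max_arity (coloured L_rel l)))
        {M \<in> S.struct n ` S.samples n. models n (reduct M) \<phi>}" for n
    unfolding delta_S_def delta_SK_def Sn_def SKn by (rule arg_cong[where f = "measure _"]) auto
  ultimately show ?thesis
    using K.zero_one_law[OF assms(5)] S.zero_one_law[OF assms(5)] by simp
qed

end
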